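(* Let $m,n\ge 1$ be integers and let $a>1$ be a fixed real number. Let $r(\mathcal{A}_n^{(m)})$ denote the number of regions of $\mathcal{A}_n^{(m)}$, and let $r_0(\mathcal{A}_n^{(m)})$ denote the number of those regions whose points $(x_1,\dots,x_n)$ satisfy $x_1<x_2<\cdots<x_n$. Then $$r_0(\mathcal{A}_n^{(m)})=\frac{2}{n(m+1)+2}\binom{n(m+1)+2}{n}=A_n(m,2)\qquad\text{and}\qquad r(\mathcal{A}_n^{(m)})=n!\cdot A_n(m,2).$$
   Context: $\mathcal{A}_n^{(m)}$ denotes the hyperplane arrangement in $\mathbb{R}^n$ given by $\{x_i=0 \mid i\in[n]\}\cup\{x_i=a^kx_j \mid k\in[-m,m],\ 1\le i<j\le n\}$, where $[n]=\{1,\dots,n\}$ and $[-m,m]$ is the set of integers from $-m$ to $m$. A region of an arrangement is a connected component of the complement in $\mathbb{R}^n$ of the union of its hyperplanes. (Since the hyperplanes $x_i=x_j$ belong to $\mathcal{A}_n^{(m)}$, the relative order of the coordinates is constant on each region.) The two parameter Fuss-Catalan numbers (Raney numbers) are $A_n(m,r)=\frac{r}{n(m+1)+r}\binom{n(m+1)+r}{n}$. *)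

theory Defs
  imports "HOL-Analysis.Analysis"
begin

text \<open>
  Real n-space is modelled by the functions in \<open>{1..n} \<rightarrow>\<^sub>E UNIV\<close>, that is, by
  coordinates \<open>x 1, \<dots>, x n\<close> (with \<open>x i = undefined\<close> for every other \<open>i\<close>), under the
  product topology. This keeps \<open>n\<close> an ordinary number and the coordinates ordered.
\<close>

definition real_space :: "nat \<Rightarrow> (nat \<Rightarrow> real) topology" where
  "real_space n = powertop_real {1..n}"

definition arrangement :: "real \<Rightarrow> nat \<Rightarrow> nat \<Rightarrow> (nat \<Rightarrow> real) set set" where
  "arrangement a m n =
     {{x \<in> topspace (real_space n). x i = 0} | i. i \<in> {1..n}} \<union>
     {{x \<in> topspace (real_space n). x i = a powi k * x j} | i j k.
        k \<in> {- int m..int m} \<and> 1 \<le> i \<and> i < j \<and> j \<le> n}"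

definition regions :: "nat \<Rightarrow> (nat \<Rightarrow> real) set set \<Rightarrow> (nat \<Rightarrow> real) set set" where
  "regions n \<A> =
     connected_components_of (subtopology (real_space n) (topspace (real_space n) - \<Union>\<A>))"

definition num_regions :: "nat \<Rightarrow> (nat \<Rightarrow> real) set set \<Rightarrow> nat" where
  "num_regions n \<A> = card (regions n \<A>)"

definition num_increasing_regions :: "nat \<Rightarrow> (nat \<Rightarrow> real) set set \<Rightarrow> nat" where
  "num_increasing_regions n \<A> =
     card {R \<in> regions n \<A>. \<forall>x\<in>R. \<forall>i\<in>{1..n}. \<forall>j\<in>{1..n}. i < j \<longrightarrow> x i < x j}"

definition raney :: "nat \<Rightarrow> nat \<Rightarrow> nat \<Rightarrow> real" where
  "raney n m r = real r / real (n * (m + 1) + r) * real ((n * (m + 1) + r) choose n)"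

end

theory Submission
  imports Defs
begin

text \<open>
  On the complement, a point is located by the signs of its coordinates and of the forms
  \<open>x i - a ^ k * x j\<close>. Each joint choice of signs cuts out a convex set, and no connected subset of
  the complement can change a sign, so the regions are exactly the nonempty sign classes
  (\<open>regions_eq\<close>). Counting regions thus means finding a complete invariant of sign classes and the
  set of its values.

  Take a point with increasing coordinates. A form comparing a negative coordinate with a positive
  one has a predetermined sign, so the class splits into independent data for the positive
  coordinates, read upwards, and for the absolute values of the negative ones, also read upwards.
  Each half is an increasing chain of positive numbers \<open>z 0 < z 1 < \<dots>\<close>, and (after taking
  logarithms) this is the extended Catalan arrangement in the dominant chamber. The barriers
  \<open>a ^ k * z j\<close> with \<open>1 \<le> k \<le> m\<close> act as a first-in first-out queue: the entry \<open>z i\<close> must be placed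
  in some gap between the barriers of its predecessors, and afterwards it contributes \<open>m\<close> barriers
  of its own. Record for each \<open>i\<close> the slack \<open>t i\<close>, the number of earlier barriers still above \<open>z i\<close>.
  Then \<open>t 0 = 0\<close> and \<open>t (i + 1) \<le> t i + m\<close>. Every such sequence occurs, by placing the entries
  greedily (\<open>profile_surj\<close>). It also determines the class (\<open>profile_eq_iff\<close>): the relative
  order of the barriers is itself a consequence of comparisons among earlier entries, so the mere
  number of barriers above \<open>z i\<close> tells which ones they are.

  The slack sequences satisfy the recurrence \<open>A (n + 1) (r + 1) = A (n + 1) r + A n (r + 1 + m)\<close> of
  the Raney numbers (\<open>raney_nat m\<close>), where \<open>r - 1\<close> bounds the first slack; one chain is the case \<open>r = 1\<close>. The same
  recurrence yields the convolution identity that merges the two halves into \<open>r = 2\<close>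
  (\<open>raney_nat_convolution\<close>). Finally the arrangement is invariant under permuting coordinates, which are
  pairwise distinct on the complement, and sorting them accounts for the factor \<open>fact n\<close>.
\<close>

section \<open>Raney numbers and slack sequences\<close>

text \<open>
  The integer form of the Raney numbers: the recurrence makes sense also at \<open>n = r = 0\<close>, where the
  closed formula reads \<open>0 / 0\<close> and thus gives \<open>0\<close>, while the convolution needs the value \<open>1\<close>.
\<close>

fun raney_nat :: "nat \<Rightarrow> nat \<Rightarrow> nat \<Rightarrow> nat" where
  "raney_nat m 0 r = 1"
| "raney_nat m (Suc n) 0 = 0"
| "raney_nat m (Suc n) (Suc r) = raney_nat m (Suc n) r + raney_nat m n (Suc r + m)"

text \<open>
  Both sides, as functions of \<open>r\<close>, start from the same value at \<open>r = 0\<close> and have increments in \<open>r\<close>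
  that agree by the induction hypothesis for \<open>n\<close>.
\<close>

lemma raney_nat_convolution:
  "(\<Sum>j\<le>n. raney_nat m j r * raney_nat m (n - j) r') = raney_nat m n (r + r')"
proof (induction n arbitrary: r)
  case 0
  show ?case by simp
next
  case (Suc n)
  note IH = Suc
  show ?case
  proof (induction r)
    case 0
    have "(\<Sum>j\<le>Suc n. raney_nat m j 0 * raney_nat m (Suc n - j) r')
        = raney_nat m 0 0 * raney_nat m (Suc n - 0) r' + (\<Sum>j\<le>n. raney_nat m (Suc j) 0 * raney_nat m (Suc n - Suc j) r')"
      by (rule sum.atMost_Suc_shift)
    then show ?case by simp
  next
    case (Suc r)
    have *: "(\<Sum>j\<le>Suc n. raney_nat m j r'' * raney_nat m (Suc n - j) r')
        = raney_nat m (Suc n) r' + (\<Sum>j\<le>n. raney_nat m (Suc j) r'' * raney_nat m (n - j) r')" for r''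
      by (subst sum.atMost_Suc_shift) simp
    have "(\<Sum>j\<le>Suc n. raney_nat m j (Suc r) * raney_nat m (Suc n - j) r')
       = (\<Sum>j\<le>Suc n. raney_nat m j r * raney_nat m (Suc n - j) r')
         + (\<Sum>j\<le>n. raney_nat m j (Suc r + m) * raney_nat m (n - j) r')"
      unfolding * by (simp add: algebra_simps sum.distrib)
    also have "\<dots> = raney_nat m (Suc n) (r + r') + raney_nat m n (Suc r + m + r')"
      by (simp only: Suc IH)
    also have "\<dots> = raney_nat m (Suc n) (Suc r + r')"
      by (simp add: add.commute add.left_commute)
    finally show ?case .
  qed
qed

text \<open>
  All three binomials are multiples of \<open>N choose n\<close> with \<open>N = n * (m + 1) + m + 1 + r\<close>; what remains is
  the identity \<open>(r + 1) * N = r * (N - n) + (n + 1) * (r + 1 + m)\<close>.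
\<close>

lemma raney_Suc:
  "raney (Suc n) m (Suc r) = raney (Suc n) m r + raney n m (Suc r + m)"
proof -
  define N where "N = n * (m + 1) + m + 1 + r"
  have e1: "raney (Suc n) m (Suc r) = real (Suc r) / real (Suc N) * real (Suc N choose Suc n)"
    by (simp add: raney_def N_def algebra_simps)
  have e2: "raney (Suc n) m r = real r / real N * real (N choose Suc n)"
    by (simp add: raney_def N_def algebra_simps)
  have e3: "raney n m (Suc r + m) = real (Suc r + m) / real N * real (N choose n)"
    by (simp add: raney_def N_def algebra_simps)
  have "N > 0" and nN: "n \<le> N" and N1: "real N = real n * (real m + 1) + real m + 1 + real r"
    by (simp_all add: N_def algebra_simps)
  then have N0: "real N > 0" by simp
  have p: "real (Suc N choose Suc n) = real (Suc N) / real (Suc n) * real (N choose n)"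
    using Suc_times_binomial_eq[of N n] by (simp add: field_simps flip: of_nat_mult of_nat_Suc)
  have q: "real (N choose Suc n) = real (N - n) / real (Suc n) * real (N choose n)"
  proof -
    have "Suc n * (N choose Suc n) = (N - n) * (N choose n)"
      using binomial_absorb_comp[of N n] binomial_absorption[of n N] by simp
    then have "real (Suc n) * real (N choose Suc n) = real (N - n) * real (N choose n)"
      by (metis of_nat_mult)
    then show ?thesis by (simp add: field_simps)
  qed
  have "real (Suc r) * real N = real r * (real N - real n) + real (Suc n) * real (Suc r + m)"
    unfolding N1 by (simp add: algebra_simps)
  then have k: "real (Suc r) / real (Suc n)
      = real r / real N * ((real N - real n) / real (Suc n)) + real (Suc r + m) / real N"
    using N0 by (simp add: divide_simps)
  have "real (Suc r) / real (Suc N) * (real (Suc N) / real (Suc n) * real (N choose n))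
      = real (Suc r) / real (Suc n) * real (N choose n)"
    by simp
  also have "\<dots> = real r / real N * (real (N - n) / real (Suc n) * real (N choose n))
      + real (Suc r + m) / real N * real (N choose n)"
    unfolding k using nN by (simp only: of_nat_diff) (simp only: distrib_right mult.assoc)
  finally show ?thesis unfolding e1 e2 e3 p q .
qed

lemma raney_nat_eq_raney: "n > 0 \<or> r > 0 \<Longrightarrow> real (raney_nat m n r) = raney n m r"
proof (induction m n r rule: raney_nat.induct)
  case (1 m r)
  then show ?case by (simp add: raney_def)
next
  case (2 m n)
  then show ?case by (simp add: raney_def)
next
  case (3 m n r)
  then show ?case using raney_Suc[of n m r] by simp
qed

text \<open>
  The sequences produced by a queue that receives \<open>m\<close> new items after each step and drops any number
  of items before each step; \<open>s\<close> is the present length of the queue.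
\<close>

fun slack_ok :: "nat \<Rightarrow> nat \<Rightarrow> nat list \<Rightarrow> bool" where
  "slack_ok m s [] = True"
| "slack_ok m s (t # ts) = (t \<le> s \<and> slack_ok m (t + m) ts)"

lemma sum_raney_nat: "(\<Sum>t\<le>s. raney_nat m n (Suc t + m)) = raney_nat m (Suc n) (Suc s)"
  by (induction s) (auto)

lemma card_slack_ok:
  "finite {ts. length ts = n \<and> slack_ok m s ts} \<and> card {ts. length ts = n \<and> slack_ok m s ts} = raney_nat m n (Suc s)"
proof (induction n arbitrary: s)
  case 0
  have "{ts. length ts = 0 \<and> slack_ok m s ts} = {[]}" by auto
  then show ?case by simp
next
  case (Suc n)
  let ?W = "\<lambda>n s. {ts. length ts = n \<and> slack_ok m s ts}"
  have e: "?W (Suc n) s = (\<Union>t\<in>{..s}. (#) t ` ?W n (t + m))"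
    by (auto simp: length_Suc_conv)
  have "card (?W (Suc n) s) = (\<Sum>t\<le>s. card ((#) t ` ?W n (t + m)))"
    unfolding e by (rule card_UN_disjoint) (use Suc in auto)
  also have "\<dots> = (\<Sum>t\<le>s. raney_nat m n (Suc t + m))"
    using Suc by (simp add: card_image)
  finally show ?case unfolding sum_raney_nat using Suc e by simp
qed

section \<open>Increasing chains and their barriers\<close>

lemma slack_ok_snoc:
  "slack_ok m s (ts @ [t]) \<longleftrightarrow> slack_ok m s ts \<and> t \<le> (if ts = [] then s else last ts + m)"
  by (induction ts arbitrary: s) auto

text \<open>
  This chooses the gap for a new chain entry. Splitting off the least element \<open>b\<close> of the set either
  moves the search above \<open>b\<close> or settles it between \<open>u\<close> and \<open>b\<close>.
\<close>

lemma exists_threshold: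
  fixes V :: "real set"
  assumes "finite V" and "\<forall>v\<in>V. u < v" and "s \<le> card V"
  shows "\<exists>t>u. t \<notin> V \<and> card {v \<in> V. t < v} = s"
  using assms
proof (induction V arbitrary: u rule: finite_linorder_min_induct)
  case empty
  then show ?case using gt_ex by auto
next
  case (insert b V)
  show ?case
  proof (cases "s \<le> card V")
    case True
    with insert obtain t where "t > b" "t \<notin> V" "card {v \<in> V. t < v} = s" by blast
    moreover have "{v \<in> insert b V. t < v} = {v \<in> V. t < v}" using \<open>t > b\<close> by auto
    ultimately show ?thesis using insert.prems by (intro exI[of _ t]) auto
  next
    case False
    have "b \<notin> V" using insert.hyps by auto
    with False insert have s: "s = card (insert b V)" by simp
    obtain t where t: "u < t" "t < b" using insert.prems dense by blast
    then have "\<forall>v\<in>insert b V. t < v" using insert.hyps by auto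
    then have "{v \<in> insert b V. t < v} = insert b V" "t \<notin> insert b V" by auto
    with t s show ?thesis by auto
  qed
qed

locale dilation =
  fixes m :: nat and a :: real
  assumes a1: "1 < a"
begin

text \<open>
  On increasing positive entries the forms with \<open>k = 0\<close>, or with the larger entry multiplied by a
  power of \<open>a\<close>, never vanish; only the listed hyperplanes have to be avoided.
\<close>

definition generic_chain :: "nat \<Rightarrow> (nat \<Rightarrow> real) \<Rightarrow> bool" where
  "generic_chain p z \<longleftrightarrow> (\<forall>i<p. 0 < z i) \<and>
     (\<forall>j<p. \<forall>i<j. z i < z j \<and> (\<forall>k\<in>{1..m}. z j \<noteq> a ^ k * z i))"

definition slack :: "(nat \<Rightarrow> real) \<Rightarrow> nat \<Rightarrow> nat" where
  "slack z i = card {(j, k) \<in> {..<i} \<times> {1..m}. z i < a ^ k * z j}"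

definition profile :: "nat \<Rightarrow> (nat \<Rightarrow> real) \<Rightarrow> nat list" where
  "profile p z = map (slack z) [0..<p]"

lemma profile_Suc: "profile (Suc p) z = profile p z @ [slack z p]"
  by (simp add: profile_def)

lemma profile_cong:
  assumes "\<And>i. i < p \<Longrightarrow> z i = y i"
  shows "profile p z = profile p y"
proof -
  have "slack z i = slack y i" if "i < p" for i
    unfolding slack_def using assms that by (intro arg_cong[where f = card]) auto
  then show ?thesis by (auto simp: profile_def)
qed

lemma slack_0: "slack z 0 = 0"
  by (simp add: slack_def)

text \<open>
  All \<open>m\<close> barriers of an entry lie above it, so \<open>slack z p + m\<close> is the queue length available to the
  next entry.
\<close>

lemma barrier_count_after:
  assumes "0 < z p"
  shows "card {(j, k) \<in> {..<Suc p} \<times> {1..m}. z p < a ^ k * z j} = slack z p + m"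
proof -
  have "{(j, k) \<in> {..<Suc p} \<times> {1..m}. z p < a ^ k * z j}
      = {(j, k) \<in> {..<p} \<times> {1..m}. z p < a ^ k * z j} \<union> {p} \<times> {1..m}"
    using assms a1 by (auto simp: less_Suc_eq one_less_power)
  moreover have "finite {(j, k) \<in> {..<p} \<times> {1..m}. z p < a ^ k * z j}"
    by (rule finite_subset[of _ "{..<p} \<times> {1..m}"]) auto
  ultimately show ?thesis
    unfolding slack_def by (simp only: ) (subst card_Un_disjoint, auto)
qed

lemma slack_ok_profile: "generic_chain p z \<Longrightarrow> slack_ok m 0 (profile p z)"
proof (induction p)
  case 0
  then show ?case by (simp add: profile_def)
next
  case (Suc p)
  then have IH: "slack_ok m 0 (profile p z)" by (simp add: generic_chain_def)
  show ?case
  proof (cases p)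
    case 0
    then show ?thesis by (simp add: profile_def slack_0)
  next
    case (Suc q)
    have z: "0 < z q" "z q < z p" using Suc.prems Suc by (auto simp: generic_chain_def)
    have "slack z p \<le> card {(j, k) \<in> {..<Suc q} \<times> {1..m}. z q < a ^ k * z j}"
      unfolding slack_def Suc
      by (rule card_mono, rule finite_subset[of _ "{..<p} \<times> {1..m}"]) (use z Suc in auto)
    then have "slack z p \<le> slack z q + m" using barrier_count_after z by simp
    then show ?thesis using IH unfolding profile_Suc slack_ok_snoc
      by (auto simp: Suc profile_Suc)
  qed
qed

text \<open>
  Two equal barriers would put a pair of entries on a hyperplane. Injectivity lets the elements of the
  set of barriers be counted by their indices.
\<close>

lemma barriers_inj:
  assumes "generic_chain p z"
  shows "inj_on (\<lambda>(j, k). a ^ k * z j) ({..<p} \<times> {1..m})"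
proof -
  have lt: False if "j < j'" "j' < p" "k \<in> {1..m}" "k' \<in> {1..m}" "a ^ k * z j = a ^ k' * z j'" for j j' k k'
  proof -
    have z: "0 < z j" "z j < z j'" "\<forall>l\<in>{1..m}. z j' \<noteq> a ^ l * z j"
      using assms that by (auto simp: generic_chain_def)
    show False
    proof (cases "k \<le> k'")
      case True
      then have "a ^ k \<le> a ^ k'" using a1 by (simp add: power_increasing)
      then have "a ^ k * z j < a ^ k' * z j'" using z a1 by (intro mult_le_less_imp_less) auto
      with that show False by simp
    next
      case False
      then have "a ^ k = a ^ k' * a ^ (k - k')" by (simp flip: power_add)
      with that have "z j' = a ^ (k - k') * z j" using a1 by simp
      moreover have "k - k' \<in> {1..m}" using False that by auto
      ultimately show False using z(3) by blast
    qed
  qed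
  show ?thesis
  proof (rule inj_onI)
    fix b b' assume b: "b \<in> {..<p} \<times> {1..m}" "b' \<in> {..<p} \<times> {1..m}"
      "(case b of (j, k) \<Rightarrow> a ^ k * z j) = (case b' of (j, k) \<Rightarrow> a ^ k * z j)"
    obtain j k j' k' where jk: "b = (j, k)" "b' = (j', k')" by fastforce
    with b have h: "j \<in> {..<p}" "k \<in> {1..m}" "j' \<in> {..<p}" "k' \<in> {1..m}" "a ^ k * z j = a ^ k' * z j'"
      by auto
    then have "j = j'" using lt[of j j' k k'] lt[of j' j k' k]
        by (cases j j' rule: linorder_cases) auto
    moreover have "z j > 0" using assms h by (auto simp: generic_chain_def)
    ultimately show "b = b'" using h a1 by (simp add: jk)
  qed
qed

text \<open>
  The entries can be placed one after the other: the bound on the next slack says precisely that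
  enough barriers lie above the last entry, and any gap above that entry is admissible.
\<close>

lemma profile_surj: "slack_ok m 0 ts \<Longrightarrow> \<exists>z. generic_chain (length ts) z \<and> profile (length ts) z = ts"
proof (induction ts rule: rev_induct)
  case Nil
  then show ?case by (simp add: profile_def generic_chain_def)
next
  case (snoc t ts)
  define p where "p = length ts"
  from snoc obtain z where z: "generic_chain p z" "profile p z = ts"
    and t: "t \<le> (if ts = [] then 0 else last ts + m)"
    unfolding slack_ok_snoc p_def by auto
  \<comment> \<open>The lower bound for the new entry; for the first entry only positivity is required.\<close>
  define u where "u = (if p = 0 then 0 else z (p - 1))"
  let ?v = "\<lambda>(j, k). a ^ k * z j"
  define V where "V = {v \<in> ?v ` ({..<p} \<times> {1..m}). u < v}"
  have count: "card {v \<in> V. w < v} = card {(j, k) \<in> {..<p} \<times> {1..m}. w < a ^ k * z j}" if "u \<le> w" for w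
  proof -
    have "{v \<in> V. w < v} = ?v ` {(j, k) \<in> {..<p} \<times> {1..m}. w < a ^ k * z j}"
      unfolding V_def using that by auto
    moreover have "inj_on ?v {(j, k) \<in> {..<p} \<times> {1..m}. w < a ^ k * z j}"
      by (rule inj_on_subset[OF barriers_inj[OF z(1)]]) auto
    ultimately show ?thesis by (simp add: card_image)
  qed
  have "t \<le> card V"
  proof (cases p)
    case 0
    then show ?thesis using t by (simp add: p_def)
  next
    case (Suc q)
    have "V = {v \<in> V. u < v}" by (auto simp: V_def)
    then have "card V = card {(j, k) \<in> {..<p} \<times> {1..m}. u < a ^ k * z j}"
      using count[of u] by simp
    also have "\<dots> = slack z q + m"
      using barrier_count_after[of z q] z(1) Suc by (simp add: u_def generic_chain_def)
    finally show ?thesis using t z(2) Suc by (auto simp: p_def profile_Suc)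
  qed
  moreover have "finite V" "\<forall>v\<in>V. u < v" by (auto simp: V_def)
  ultimately obtain w where w: "w > u" "w \<notin> V" "card {v \<in> V. w < v} = t"
    using exists_threshold by meson
  define z' where "z' = z(p := w)"
  have u: "0 \<le> u" "\<forall>i<p. z i \<le> u"
  proof -
    show "0 \<le> u" using z(1) by (auto simp: u_def generic_chain_def less_imp_le)
    show "\<forall>i<p. z i \<le> u"
    proof (intro allI impI)
      fix i assume "i < p"
      then show "z i \<le> u" using z(1) by (cases "i = p - 1") (auto simp: u_def generic_chain_def less_imp_le)
    qed
  qed
  have avoid: "w \<noteq> a ^ k * z i" if "i < p" "k \<in> {1..m}" for i k
  proof
    assume "w = a ^ k * z i"
    moreover from this have "a ^ k * z i \<in> V" using that w(1) by (auto simp: V_def)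
    ultimately show False using w(2) by simp
  qed
  have "generic_chain (Suc p) z'"
    using z(1) u w(1) avoid unfolding generic_chain_def z'_def
    by (auto simp: less_Suc_eq intro: le_less_trans)
  moreover have "profile p z' = ts"
    using profile_cong[of p z' z] z(2) by (simp add: z'_def)
  moreover have "slack z' p = t"
  proof -
    have "slack z' p = card {(j, k) \<in> {..<p} \<times> {1..m}. w < a ^ k * z j}"
      unfolding slack_def z'_def by (intro arg_cong[where f = card]) auto
    then show ?thesis using count[of w] w by simp
  qed
  ultimately show ?case by (auto simp: p_def profile_Suc intro!: exI[of _ z'])
qed

text \<open>
  The profile is a complete invariant. By induction on \<open>j\<close>, two chains with the same profile have
  their barriers before \<open>j\<close> in the same order. The barriers above entry \<open>j\<close> form an upper segment of
  this order, and two upper segments of equal size coincide.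
\<close>

lemma profile_eq_iff:
  assumes z: "generic_chain p z" and y: "generic_chain p y"
  shows "profile p z = profile p y \<longleftrightarrow>
    (\<forall>j<p. \<forall>i<j. \<forall>k\<in>{1..m}. z j < a ^ k * z i \<longleftrightarrow> y j < a ^ k * y i)"
    (is "_ \<longleftrightarrow> ?same")
proof
  assume same: ?same
  have "slack z j = slack y j" if "j < p" for j
    unfolding slack_def using same that by (intro arg_cong[where f = card]) auto
  then show "profile p z = profile p y" by (auto simp: profile_def)
next
  assume eq: "profile p z = profile p y"
  have "\<forall>i<j. \<forall>k\<in>{1..m}. z j < a ^ k * z i \<longleftrightarrow> y j < a ^ k * y i" if "j < p" for j
    using that
  proof (induction j rule: less_induct)
    case (less j)
    let ?I = "{..<j} \<times> {1..m}"
    let ?A = "\<lambda>x::nat \<Rightarrow> real. {(i, k) \<in> ?I. x j < a ^ k * x i}"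
    \<comment> \<open>Dividing by the smaller power of \<open>a\<close> turns a comparison of two barriers into a comparison of an
      entry with a single barrier, both before \<open>j\<close>, or into one that holds or fails in every chain.\<close>
    have barrier_order: "a ^ k * x i < a ^ l * x i' \<longleftrightarrow> (if k \<le> l then i < i' \<or> i = i' \<and> k < l \<or>
          i' < i \<and> k < l \<and> x i < a ^ (l - k) * x i'
        else i < i' \<and> \<not> x i' < a ^ (k - l) * x i)"
      if x: "generic_chain p x" and ii: "i < j" "i' < j" and kl: "k \<in> {1..m}" "l \<in> {1..m}" for x i i' k l
    proof (cases "k \<le> l")
      case True
      then have "a ^ l = a ^ k * a ^ (l - k)" by (simp flip: power_add)
      then have e: "a ^ k * x i < a ^ l * x i' \<longleftrightarrow> x i < a ^ (l - k) * x i'" using a1 by simp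
      have pos: "0 < x i'" using x ii less.prems by (auto simp: generic_chain_def)
      have g: "1 \<le> a ^ (l - k)" using a1 by (simp add: one_le_power)
      have "i < i' \<Longrightarrow> x i < a ^ (l - k) * x i'"
      proof -
        assume "i < i'"
        then have "x i < x i'" using x ii less.prems by (auto simp: generic_chain_def)
        also have "\<dots> \<le> a ^ (l - k) * x i'" using g pos by simp
        finally show ?thesis .
      qed
      moreover have "x i < a ^ (l - k) * x i \<longleftrightarrow> k < l" if "i = i'"
        using pos that a1 True by (cases "k = l") (auto simp: one_less_power)
      moreover have "\<not> x i < a ^ (l - k) * x i'" if "i' < i" "k = l"
        using that x ii less.prems by (auto simp: generic_chain_def less_imp_le not_less)
      ultimately show ?thesis using True unfolding e
        by (cases i i' rule: linorder_cases) (auto simp: order.order_iff_strict)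
    next
      case False
      then have "a ^ k = a ^ l * a ^ (k - l)" by (simp flip: power_add)
      then have e: "a ^ k * x i < a ^ l * x i' \<longleftrightarrow> a ^ (k - l) * x i < x i'" using a1 by simp
      have pos: "0 < x i" using x ii less.prems by (auto simp: generic_chain_def)
      have g: "1 \<le> a ^ (k - l)" using a1 by (simp add: one_le_power)
      have "\<not> a ^ (k - l) * x i < x i'" if "i' \<le> i"
      proof -
        have "x i' \<le> x i" using that x ii less.prems
          by (cases "i = i'") (auto simp: generic_chain_def less_imp_le)
        also have "\<dots> \<le> a ^ (k - l) * x i" using g pos by simp
        finally show ?thesis by simp
      qed
      moreover have "a ^ (k - l) * x i < x i' \<longleftrightarrow> \<not> x i' < a ^ (k - l) * x i" if "i < i'"
      proof -
        have "k - l \<in> {1..m}" using False kl by auto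
        then have "x i' \<noteq> a ^ (k - l) * x i" using that x ii less.prems by (auto simp: generic_chain_def)
        then show ?thesis by auto
      qed
      ultimately show ?thesis using False unfolding e
        by (cases "i < i'") (auto simp: not_less)
    qed
    have order: "a ^ k * z i < a ^ l * z i' \<longleftrightarrow> a ^ k * y i < a ^ l * y i'"
      if "i < j" "i' < j" "k \<in> {1..m}" "l \<in> {1..m}" for i i' k l
    proof -
      have "z b < a ^ c * z b' \<longleftrightarrow> y b < a ^ c * y b'" if "b < j" "b' < b" "c \<in> {1..m}" for b b' c
        using less.IH[of b] less.prems that by auto
      moreover have "l - k \<in> {1..m}" if "k < l" using that \<open>l \<in> _\<close> by auto
      moreover have "k - l \<in> {1..m}" if "l < k" using that \<open>k \<in> _\<close> by auto
      ultimately show ?thesis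
        unfolding barrier_order[OF z that] barrier_order[OF y that] using that by auto
    qed
    have fin: "finite (?A x)" for x by (rule finite_subset[of _ ?I]) auto
    have "slack z j = slack y j" using eq less.prems by (auto simp: profile_def)
    then have card: "card (?A z) = card (?A y)" by (simp add: slack_def)
    have "?A z \<subseteq> ?A y \<or> ?A y \<subseteq> ?A z"
    proof (rule ccontr)
      assume "\<not> ?thesis"
      then obtain i k i' l where h: "(i, k) \<in> ?A z" "(i, k) \<notin> ?A y" "(i', l) \<in> ?A y" "(i', l) \<notin> ?A z"
        by blast
      then have "a ^ l * z i' < a ^ k * z i" "\<not> a ^ l * y i' < a ^ k * y i" by auto
      with order[of i' i l k] h show False by auto
    qed
    then have "?A z = ?A y"
      using card_subset_eq[OF fin _ card] card_subset_eq[OF fin _ card[symmetric]] by blast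
    then have "(i, k) \<in> ?A z \<longleftrightarrow> (i, k) \<in> ?A y" for i k by (rule eqset_imp_iff)
    then have "z j < a ^ k * z i \<longleftrightarrow> y j < a ^ k * y i" if "i < j" "k \<in> {1..m}" for i k
      using that by blast
    then show ?case by blast
  qed
  then show ?same by blast
qed

lemma generic_chain_compare:
  assumes "generic_chain p z" "i < p" "j < p" "i \<noteq> j" "k \<le> m"
  shows "z i \<noteq> a ^ k * z j"
    and "z i < a ^ k * z j \<longleftrightarrow> i < j \<or> j < i \<and> k \<in> {1..m} \<and> z i < a ^ k * z j"
proof -
  have pos: "0 < z j" using assms by (auto simp: generic_chain_def)
  have up: "z i < a ^ k * z j" if "i < j"
  proof -
    have "z i < z j" using assms that by (auto simp: generic_chain_def)
    also have "\<dots> \<le> a ^ k * z j" using pos a1 by (simp add: one_le_power)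
    finally show ?thesis .
  qed
  have down: "z j < z i" if "j < i" using assms that by (auto simp: generic_chain_def)
  show "z i \<noteq> a ^ k * z j"
  proof (cases "i < j")
    case False
    then have "j < i" using assms(4) by simp
    show ?thesis
    proof (cases "k = 0")
      case False
      then have "k \<in> {1..m}" using assms(5) by auto
      then show ?thesis using assms(1,2) \<open>j < i\<close> unfolding generic_chain_def by blast
    qed (use down \<open>j < i\<close> in auto)
  qed (use up in auto)
  show "z i < a ^ k * z j \<longleftrightarrow> i < j \<or> j < i \<and> k \<in> {1..m} \<and> z i < a ^ k * z j"
    using up down assms by (cases k) (auto simp: neq_iff)
qed

lemma profile_eq_iff_sides:
  assumes z: "generic_chain p z" and y: "generic_chain p y"
  shows "profile p z = profile p y \<longleftrightarrow> (\<forall>i<p. \<forall>j<p. i \<noteq> j \<longrightarrow>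
    (\<forall>k\<le>m. z i < a ^ k * z j \<longleftrightarrow> y i < a ^ k * y j))"
  unfolding profile_eq_iff[OF assms]
proof
  assume same: "\<forall>j<p. \<forall>i<j. \<forall>k\<in>{1..m}. z j < a ^ k * z i \<longleftrightarrow> y j < a ^ k * y i"
  have "z i < a ^ k * z j \<longleftrightarrow> y i < a ^ k * y j" if "i < p" "j < p" "i \<noteq> j" "k \<le> m" for i j k
    using generic_chain_compare(2)[OF z that] generic_chain_compare(2)[OF y that] same that(1) by blast
  then show "\<forall>i<p. \<forall>j<p. i \<noteq> j \<longrightarrow> (\<forall>k\<le>m. z i < a ^ k * z j \<longleftrightarrow> y i < a ^ k * y j)"
    by blast
qed auto

end

section \<open>Regions as sign classes\<close>

definition same_side :: "real \<Rightarrow> nat \<Rightarrow> nat \<Rightarrow> (nat \<Rightarrow> real) \<Rightarrow> (nat \<Rightarrow> real) \<Rightarrow> bool" where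
  "same_side a m n x y \<longleftrightarrow> (\<forall>i\<in>{1..n}. 0 < x i \<longleftrightarrow> 0 < y i) \<and>
     (\<forall>i\<in>{1..n}. \<forall>j\<in>{1..n}. i \<noteq> j \<longrightarrow> (\<forall>k\<le>m. x i < a ^ k * x j \<longleftrightarrow> y i < a ^ k * y j))"

text \<open>
  All ordered pairs \<open>i \<noteq> j\<close> with exponents \<open>0 \<le> k \<le> m\<close> describe the same hyperplanes as the pairs
  \<open>i < j\<close> with exponents from \<open>-m\<close> to \<open>m\<close>; in this form the invariance under permutations is evident.
\<close>

definition complement_points :: "real \<Rightarrow> nat \<Rightarrow> nat \<Rightarrow> (nat \<Rightarrow> real) set" where
  "complement_points a m n = {x \<in> {1..n} \<rightarrow>\<^sub>E UNIV. (\<forall>i\<in>{1..n}. x i \<noteq> 0) \<and>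
     (\<forall>i\<in>{1..n}. \<forall>j\<in>{1..n}. i \<noteq> j \<longrightarrow> (\<forall>k\<le>m. x i \<noteq> a ^ k * x j))}"

lemma complement_pointsD:
  assumes "x \<in> complement_points a m n" and "i \<in> {1..n}"
  shows "x i \<noteq> 0" and "j \<in> {1..n} \<Longrightarrow> i \<noteq> j \<Longrightarrow> k \<le> m \<Longrightarrow> x i \<noteq> a ^ k * x j"
proof -
  note x = assms(1)[unfolded complement_points_def mem_Collect_eq]
  note nz = x[THEN conjunct2, THEN conjunct1] and off = x[THEN conjunct2, THEN conjunct2]
  show "x i \<noteq> 0" using nz assms(2) by (rule bspec)
  show "x i \<noteq> a ^ k * x j" if "j \<in> {1..n}" "i \<noteq> j" "k \<le> m"
    using bspec[OF bspec[OF off assms(2)] that(1)] that(2,3) by simp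
qed

lemma topspace_real_space: "topspace (real_space n) = {1..n} \<rightarrow>\<^sub>E UNIV"
  by (simp add: real_space_def)

lemma complement_of_arrangement:
  assumes "0 < a"
  shows "topspace (real_space n) - \<Union>(arrangement a m n) = complement_points a m n"
proof (intro set_eqI iffI)
  fix x assume x: "x \<in> topspace (real_space n) - \<Union>(arrangement a m n)"
  have nz: "x i \<noteq> 0" if "i \<in> {1..n}" for i
  proof
    assume "x i = 0"
    then have "x \<in> \<Union>(arrangement a m n)" using x that unfolding arrangement_def by blast
    with x show False by simp
  qed
  have off: "x i \<noteq> a powi k * x j" if "1 \<le> i" "i < j" "j \<le> n" "k \<in> {- int m..int m}" for i j k
  proof
    assume "x i = a powi k * x j"
    then have "x \<in> \<Union>(arrangement a m n)" using x that unfolding arrangement_def by blast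
    with x show False by simp
  qed
  have "x i \<noteq> a ^ k * x j" if "i \<in> {1..n}" "j \<in> {1..n}" "i \<noteq> j" "k \<le> m" for i j k
  proof (cases "i < j")
    case True
    then show ?thesis using off[of i j "int k"] that by auto
  next
    case False
    have "a powi (- int k) * a ^ k = 1" using assms by (simp add: power_int_minus)
    then have "x i = a ^ k * x j \<Longrightarrow> x j = a powi (- int k) * x i"
      by (simp flip: mult.assoc)
    then show ?thesis using off[of j i "- int k"] that False by auto
  qed
  with nz x show "x \<in> complement_points a m n"
    by (auto simp: complement_points_def topspace_real_space)
next
  fix x assume x: "x \<in> complement_points a m n"
  have "x i \<noteq> a powi k * x j" if "1 \<le> i" "i < j" "j \<le> n" "k \<in> {- int m..int m}" for i j k
  proof (cases "0 \<le> k")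
    case True
    then have "a powi k = a ^ nat k" "nat k \<le> m" using that by (auto simp: power_int_def)
    then show ?thesis using x that by (auto simp: complement_points_def)
  next
    case False
    then have "a powi k * a ^ nat (- k) = 1" "nat (- k) \<le> m"
      using that assms by (auto simp: power_int_def field_simps)
    moreover from this have "x i = a powi k * x j \<Longrightarrow> x j = a ^ nat (- k) * x i"
      by (metis mult.assoc mult.commute mult_1)
    moreover have "x j \<noteq> a ^ nat (- k) * x i" if "nat (- k) \<le> m"
      using x that \<open>1 \<le> i\<close> \<open>i < j\<close> \<open>j \<le> n\<close> by (auto simp: complement_points_def)
    ultimately show ?thesis by blast
  qed
  then show "x \<in> topspace (real_space n) - \<Union>(arrangement a m n)"
    using x by (auto simp: complement_points_def arrangement_def topspace_real_space)
qed

lemma connectedin_same_sign: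
  fixes f :: "'a \<Rightarrow> real"
  assumes "connectedin X C" and "continuous_map X euclideanreal f" and "\<forall>x\<in>C. f x \<noteq> 0"
    and "x \<in> C" and "y \<in> C"
  shows "0 < f x \<longleftrightarrow> 0 < f y"
proof -
  have "connected (f ` C)"
    using connectedin_continuous_map_image[OF assms(2,1)] by simp
  then have "\<And>u v. u \<in> f ` C \<Longrightarrow> v \<in> f ` C \<Longrightarrow> {u..v} \<subseteq> f ` C"
    by (rule connected_contains_Icc)
  moreover have "0 \<notin> f ` C" using assms(3) by auto
  ultimately have "\<not> (u < 0 \<and> 0 < v)" if "u \<in> f ` C" "v \<in> f ` C" for u v
    using that by (meson atLeastAtMost_iff less_imp_le subset_iff)
  then show ?thesis using assms(3-5) by (metis imageI linorder_neqE_linordered_idom)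
qed

lemma convex_pos:
  fixes u v t :: real
  assumes "0 \<le> t" "t \<le> 1" "0 < u" "0 < v"
  shows "0 < (1 - t) * u + t * v"
  using assms by (cases "t = 0") (auto intro: add_nonneg_pos)

lemma convex_same_sign:
  fixes u v t :: real
  assumes "0 \<le> t" "t \<le> 1" "u \<noteq> 0" "v \<noteq> 0" "0 < u \<longleftrightarrow> 0 < v"
  shows "(1 - t) * u + t * v \<noteq> 0 \<and> (0 < (1 - t) * u + t * v \<longleftrightarrow> 0 < u)"
proof (cases "0 < u")
  case True
  then show ?thesis using convex_pos[of t u v] assms by auto
next
  case False
  then have "0 < (1 - t) * - u + t * - v" using assms by (intro convex_pos) auto
  then show ?thesis using False by (simp only: mult_minus_right) auto
qed

text \<open>
  Connectedness confines a component to one sign class. Conversely, a linear form with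
  the same nonzero sign at two points keeps it along the segment between them.
\<close>

lemma connected_component_eq_same_side:
  assumes x: "x \<in> complement_points a m n"
  defines "X \<equiv> subtopology (real_space n) (complement_points a m n)"
  shows "connected_component_of_set X x = {y \<in> complement_points a m n. same_side a m n x y}"
proof (intro set_eqI iffI)
  fix y assume "y \<in> connected_component_of_set X x"
  then obtain C where C: "connectedin X C" "x \<in> C" "y \<in> C"
    by (auto simp: connected_component_of_def)
  then have sub: "C \<subseteq> complement_points a m n"
    using connectedin_subset_topspace[of X C] by (auto simp: X_def)
  then have y: "y \<in> complement_points a m n" using C by auto
  have coord: "continuous_map X euclideanreal (\<lambda>x. x i)" if "i \<in> {1..n}" for i
    unfolding X_def real_space_def
    by (intro continuous_map_from_subtopology continuous_map_product_projection that)
  have "0 < x i \<longleftrightarrow> 0 < y i" if "i \<in> {1..n}" for i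
    by (rule connectedin_same_sign[OF C(1) coord[OF that] _ C(2,3)])
      (use sub that in \<open>auto simp: complement_points_def\<close>)
  moreover have "x i < a ^ k * x j \<longleftrightarrow> y i < a ^ k * y j"
    if "i \<in> {1..n}" "j \<in> {1..n}" "i \<noteq> j" "k \<le> m" for i j k
  proof -
    have "0 < a ^ k * x j - x i \<longleftrightarrow> 0 < a ^ k * y j - y i"
      by (rule connectedin_same_sign[OF C(1) _ _ C(2,3)])
        (use sub that in \<open>fastforce simp: complement_points_def intro!: continuous_intros coord\<close>)+
    then show ?thesis by simp
  qed
  ultimately have "same_side a m n x y" by (auto simp: same_side_def)
  with y show "y \<in> {y \<in> complement_points a m n. same_side a m n x y}" by simp
next
  fix y assume "y \<in> {y \<in> complement_points a m n. same_side a m n x y}"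
  then have y: "y \<in> complement_points a m n" and s: "same_side a m n x y" by auto
  define g where "g t = (\<lambda>i\<in>{1..n}. (1 - t) * x i + t * y i)" for t
  have "g t \<in> complement_points a m n" if t: "t \<in> {0..1}" for t
  proof -
    have "(1 - t) * x i + t * y i \<noteq> 0" if "i \<in> {1..n}" for i
      using convex_same_sign[of t "x i" "y i"] x y s t that
      by (auto simp: complement_points_def same_side_def)
    moreover have "(1 - t) * x i + t * y i \<noteq> a ^ k * ((1 - t) * x j + t * y j)"
      if "i \<in> {1..n}" "j \<in> {1..n}" "i \<noteq> j" "k \<le> m" for i j k
    proof -
      have "(1 - t) * (a ^ k * x j - x i) + t * (a ^ k * y j - y i) \<noteq> 0"
      proof (rule convex_same_sign[THEN conjunct1])
        have "x i \<noteq> a ^ k * x j" "y i \<noteq> a ^ k * y j"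
          using complement_pointsD(2) x y that by simp_all
        then show "a ^ k * x j - x i \<noteq> 0" "a ^ k * y j - y i \<noteq> 0" by auto
        show "0 < a ^ k * x j - x i \<longleftrightarrow> 0 < a ^ k * y j - y i"
          using s that by (simp add: same_side_def)
      qed (use t in auto)
      then show ?thesis by (simp add: algebra_simps)
    qed
    ultimately show ?thesis by (auto simp: complement_points_def g_def)
  qed
  moreover have "continuous_map (top_of_set {0..1}) (real_space n) g"
    unfolding real_space_def g_def continuous_map_componentwise
    by (auto intro!: continuous_intros)
  ultimately have "continuous_map (top_of_set {0..1}) X g"
    by (auto simp: X_def continuous_map_in_subtopology)
  moreover have "connectedin (top_of_set {0..1::real}) {0..1}"
    by (simp add: connectedin_subtopology)
  ultimately have "connectedin X (g ` {0..1})"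
    by (rule connectedin_continuous_map_image)
  moreover have "g 0 = x" "g 1 = y"
    using x y by (auto simp: g_def complement_points_def PiE_iff extensional_def fun_eq_iff)
  then have "x \<in> g ` {0..1}" "y \<in> g ` {0..1}"
    by (force simp: image_iff)+
  ultimately show "y \<in> connected_component_of_set X x"
    unfolding connected_component_of_def by blast
qed

lemma regions_eq:
  assumes "0 < a"
  shows "regions n (arrangement a m n)
    = (\<lambda>x. {y \<in> complement_points a m n. same_side a m n x y}) ` complement_points a m n"
proof -
  have "complement_points a m n \<subseteq> topspace (real_space n)"
    by (auto simp: complement_points_def topspace_real_space)
  then have "topspace (subtopology (real_space n) (complement_points a m n)) = complement_points a m n"
    by auto
  then show ?thesis
    unfolding regions_def connected_components_of_def complement_of_arrangement[OF assms]
    using connected_component_eq_same_side by (simp cong: image_cong)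
qed

section \<open>Sign classes of increasing points\<close>

text \<open>
  Used for the indices of the negative coordinates of an increasing point, which form an initial
  segment.
\<close>

lemma down_closed_interval:
  fixes S :: "nat set"
  assumes "S \<subseteq> {1..n}" and "\<And>i j. j \<in> S \<Longrightarrow> 1 \<le> i \<Longrightarrow> i \<le> j \<Longrightarrow> i \<in> S"
  shows "S = {1..card S}"
proof (cases "S = {}")
  case False
  have fin: "finite S" using assms(1) finite_subset by blast
  have S: "S = {1..Max S}"
  proof
    show "S \<subseteq> {1..Max S}" using assms(1) Max_ge[OF fin] by auto
    show "{1..Max S} \<subseteq> S" using assms(2)[OF Max_in[OF fin False]] by auto
  qed
  then have "card S = card {1..Max S}" by (rule arg_cong)
  then have "card S = Max S" by simp
  then show ?thesis using S by simp
qed simp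

context dilation
begin

definition increasing_points :: "nat \<Rightarrow> (nat \<Rightarrow> real) set" where
  "increasing_points n = {x \<in> complement_points a m n.
     \<forall>i\<in>{1..n}. \<forall>j\<in>{1..n}. i < j \<longrightarrow> x i < x j}"

lemma increasing_pointsD:
  assumes "x \<in> increasing_points n"
  shows "x \<in> complement_points a m n" and "i \<in> {1..n} \<Longrightarrow> j \<in> {1..n} \<Longrightarrow> i < j \<Longrightarrow> x i < x j"
  using assms by (simp_all add: increasing_points_def)

definition negatives :: "nat \<Rightarrow> (nat \<Rightarrow> real) \<Rightarrow> nat" where
  "negatives n x = card {i \<in> {1..n}. x i < 0}"

text \<open>
  The negative half is reflected, \<open>i \<mapsto> - x (q - i)\<close>, so that it too becomes an increasing chain of
  positive numbers.
\<close>

definition two_sided_profile :: "nat \<Rightarrow> (nat \<Rightarrow> real) \<Rightarrow> nat list \<times> nat list" where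
  "two_sided_profile n x = (let q = negatives n x in
     (profile (n - q) (\<lambda>i. x (Suc (q + i))), profile q (\<lambda>i. - x (q - i))))"

lemma negatives_le: "negatives n x \<le> n"
  unfolding negatives_def by (rule order_trans[OF card_mono[of "{1..n}"]]) auto

lemma negative_iff:
  assumes "x \<in> increasing_points n" "i \<in> {1..n}"
  shows "x i < 0 \<longleftrightarrow> i \<le> negatives n x"
proof -
  let ?S = "{i \<in> {1..n}. x i < 0}"
  have "i \<in> ?S" if "j \<in> ?S" "1 \<le> i" "i \<le> j" for i j
  proof (cases "i = j")
    case False
    then have "x i < x j" using increasing_pointsD(2)[OF assms(1)] assms that by auto
    with that show ?thesis by auto
  qed (use that in auto)
  then have "?S = {1..negatives n x}"
    unfolding negatives_def by (intro down_closed_interval) auto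
  then have "i \<in> ?S \<longleftrightarrow> i \<in> {1..negatives n x}" by (rule eqset_imp_iff)
  then show ?thesis using assms(2) by simp
qed

lemma pos_iff_not_neg: "x \<in> increasing_points n \<Longrightarrow> i \<in> {1..n} \<Longrightarrow> 0 < x i \<longleftrightarrow> \<not> x i < 0"
proof -
  assume "x \<in> increasing_points n" "i \<in> {1..n}"
  then have "x i \<noteq> 0" using complement_pointsD(1)[OF increasing_pointsD(1)] by blast
  then show ?thesis by linarith
qed

lemma generic_halves:
  assumes x: "x \<in> increasing_points n"
  defines "q \<equiv> negatives n x"
  shows "generic_chain (n - q) (\<lambda>i. x (Suc (q + i)))" and "generic_chain q (\<lambda>i. - x (q - i))"
proof -
  have q: "q \<le> n" using negatives_le by (simp add: q_def)
  have inc: "x i < x j" if "i \<in> {1..n}" "j \<in> {1..n}" "i < j" for i j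
    using increasing_pointsD(2)[OF x] that by blast
  have off: "x i \<noteq> a ^ k * x j" if "i \<in> {1..n}" "j \<in> {1..n}" "i \<noteq> j" "k \<le> m" for i j k
    using that by (rule complement_pointsD(2)[OF increasing_pointsD(1)[OF x]])
  have sgn: "x i < 0 \<longleftrightarrow> i \<le> q" "0 < x i \<longleftrightarrow> q < i" if "i \<in> {1..n}" for i
    using negative_iff[OF x that] pos_iff_not_neg[OF x that] by (auto simp: q_def)
  show "generic_chain (n - q) (\<lambda>i. x (Suc (q + i)))"
    unfolding generic_chain_def using sgn inc off by auto
  show "generic_chain q (\<lambda>i. - x (q - i))"
    unfolding generic_chain_def
  proof (intro conjI allI impI ballI)
    fix i assume "i < q"
    then have "q - i \<in> {1..n}" using q by auto
    then show "0 < - x (q - i)" using sgn(1) by simp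
  next
    fix i j assume ij: "j < q" "i < j"
    then have mem: "q - i \<in> {1..n}" "q - j \<in> {1..n}" "q - j < q - i" using q by auto
    then show "- x (q - i) < - x (q - j)" using inc by simp
    fix k assume "k \<in> {1..m}"
    then show "- x (q - j) \<noteq> a ^ k * - x (q - i)" using off[of "q - j" "q - i" k] mem by simp
  qed
qed

text \<open>
  The length of the second list recovers the number of negative coordinates. Given that number, the
  forms relating a negative and a positive coordinate carry no information, and the others are
  comparisons within one of the two chains.
\<close>

lemma same_side_iff_profile:
  assumes x: "x \<in> increasing_points n" and y: "y \<in> increasing_points n"
  shows "same_side a m n x y \<longleftrightarrow> two_sided_profile n x = two_sided_profile n y"
proof -
  have neg_eq: "negatives n x = negatives n y" if "same_side a m n x y"
  proof -
    have "{i \<in> {1..n}. x i < 0} = {i \<in> {1..n}. y i < 0}"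
      using that pos_iff_not_neg[OF x] pos_iff_not_neg[OF y] by (auto simp: same_side_def)
    then show ?thesis by (simp add: negatives_def)
  qed
  have neg_eq': "negatives n x = negatives n y" if "two_sided_profile n x = two_sided_profile n y"
  proof -
    have "length (snd (two_sided_profile n x)) = length (snd (two_sided_profile n y))"
      using that by simp
    then show ?thesis by (simp add: two_sided_profile_def Let_def profile_def)
  qed
  have main: "same_side a m n x y \<longleftrightarrow> two_sided_profile n x = two_sided_profile n y"
    if q: "negatives n x = negatives n y"
  proof -
    define q where "q = negatives n x"
    have qn: "q \<le> n" using negatives_le by (simp add: q_def)
    note gx = generic_halves[OF x, folded q_def]
    note gy = generic_halves[OF y, folded q, folded q_def]
    have nx: "x i < 0 \<longleftrightarrow> i \<le> q" "0 < x i \<longleftrightarrow> q < i" if "i \<in> {1..n}" for i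
      using negative_iff[OF x that] pos_iff_not_neg[OF x that] by (auto simp: q_def)
    have ny: "y i < 0 \<longleftrightarrow> i \<le> q" "0 < y i \<longleftrightarrow> q < i" if "i \<in> {1..n}" for i
      using negative_iff[OF y that] pos_iff_not_neg[OF y that] q by (auto simp: q_def)
    let ?same = "\<lambda>i j. \<forall>k\<le>m. x i < a ^ k * x j \<longleftrightarrow> y i < a ^ k * y j"
    \<comment> \<open>Reflection negates each comparison, as equality is excluded on the complement.\<close>
    have flip: "- u (q - i) < a ^ k * - u (q - j) \<longleftrightarrow> \<not> u (q - i) < a ^ k * u (q - j)"
      if "u \<in> increasing_points n" "i < q" "j < q" "i \<noteq> j" "k \<le> m" for u i j k
    proof -
      have "q - i \<in> {1..n}" "q - j \<in> {1..n}" "q - i \<noteq> q - j" using that qn by auto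
      then have "u (q - i) \<noteq> a ^ k * u (q - j)"
        using complement_pointsD(2)[OF increasing_pointsD(1)] that(1,5) by blast
      then show ?thesis by auto
    qed
    have both: "(- x (q - i) < a ^ k * - x (q - j) \<longleftrightarrow> - y (q - i) < a ^ k * - y (q - j)) \<longleftrightarrow>
        (x (q - i) < a ^ k * x (q - j) \<longleftrightarrow> y (q - i) < a ^ k * y (q - j))"
      if "i < q" "j < q" "i \<noteq> j" "k \<le> m" for i j k
      unfolding flip[OF x that] flip[OF y that] by argo
    have neg: "profile q (\<lambda>i. - x (q - i)) = profile q (\<lambda>i. - y (q - i)) \<longleftrightarrow>
        (\<forall>i<q. \<forall>j<q. i \<noteq> j \<longrightarrow> ?same (q - i) (q - j))"
      unfolding profile_eq_iff_sides[OF gx(2) gy(2)]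
      by (intro all_cong imp_cong refl both)
    have "two_sided_profile n x = two_sided_profile n y \<longleftrightarrow>
        (\<forall>i<n - q. \<forall>j<n - q. i \<noteq> j \<longrightarrow> ?same (Suc (q + i)) (Suc (q + j))) \<and>
        (\<forall>i<q. \<forall>j<q. i \<noteq> j \<longrightarrow> ?same (q - i) (q - j))"
      unfolding two_sided_profile_def Let_def q[symmetric] q_def[symmetric] prod.inject
        profile_eq_iff_sides[OF gx(1) gy(1)] neg by (rule refl)
    also have "\<dots> \<longleftrightarrow> same_side a m n x y"
    proof
      assume "same_side a m n x y"
      then show "(\<forall>i<n - q. \<forall>j<n - q. i \<noteq> j \<longrightarrow> ?same (Suc (q + i)) (Suc (q + j))) \<and>
          (\<forall>i<q. \<forall>j<q. i \<noteq> j \<longrightarrow> ?same (q - i) (q - j))"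
      proof (intro conjI allI impI)
        fix i j k assume "same_side a m n x y" "i < n - q" "j < n - q" "i \<noteq> j" "k \<le> m"
        moreover from this have "Suc (q + i) \<in> {1..n}" "Suc (q + j) \<in> {1..n}" "Suc (q + i) \<noteq> Suc (q + j)"
          by auto
        ultimately show "x (Suc (q + i)) < a ^ k * x (Suc (q + j)) \<longleftrightarrow> y (Suc (q + i)) < a ^ k * y (Suc (q + j))"
          unfolding same_side_def by blast
      next
        fix i j k assume "same_side a m n x y" "i < q" "j < q" "i \<noteq> j" "k \<le> m"
        moreover from this have "q - i \<in> {1..n}" "q - j \<in> {1..n}" "q - i \<noteq> q - j"
          using qn by auto
        ultimately show "x (q - i) < a ^ k * x (q - j) \<longleftrightarrow> y (q - i) < a ^ k * y (q - j)"
          unfolding same_side_def by blast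
      qed
    next
      assume h: "(\<forall>i<n - q. \<forall>j<n - q. i \<noteq> j \<longrightarrow> ?same (Suc (q + i)) (Suc (q + j))) \<and>
          (\<forall>i<q. \<forall>j<q. i \<noteq> j \<longrightarrow> ?same (q - i) (q - j))"
      have "?same i j" if ij: "i \<in> {1..n}" "j \<in> {1..n}" "i \<noteq> j" for i j
      proof -
        consider "i \<le> q" "j \<le> q" | "q < i" "q < j" | "i \<le> q" "q < j" | "q < i" "j \<le> q" by linarith
        then show ?thesis
        proof cases
          case 1
          then have "q - i < q" "q - j < q" "q - i \<noteq> q - j" "q - (q - i) = i" "q - (q - j) = j"
            using ij by auto
          then show ?thesis using h by metis
        next
          case 2
          then have "i - Suc q < n - q" "j - Suc q < n - q" "i - Suc q \<noteq> j - Suc q"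
            "Suc (q + (i - Suc q)) = i" "Suc (q + (j - Suc q)) = j"
            using ij by auto
          then show ?thesis using h by metis
        next
          case 3
          have "u i < a ^ k * u j" if "u i < 0" "0 < u j" for u :: "nat \<Rightarrow> real" and k
          proof -
            have "0 < a ^ k * u j" using that a1 by simp
            with that show ?thesis by linarith
          qed
          then show ?thesis using 3 nx ny ij by auto
        next
          case 4
          have "\<not> u i < a ^ k * u j" if "0 < u i" "u j < 0" for u :: "nat \<Rightarrow> real" and k
          proof -
            have "a ^ k * u j < 0" using that a1 by (simp add: mult_pos_neg)
            with that show ?thesis by linarith
          qed
          then show ?thesis using 4 nx ny ij by auto
        qed
      qed
      then show "same_side a m n x y" using nx ny by (auto simp: same_side_def)
    qed
    finally show ?thesis by blast
  qed
  show ?thesis using neg_eq neg_eq' main by blast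
qed

text \<open>
  The two chains can be realised independently and put together: a hyperplane relating two
  coordinates contains no point where these have opposite signs.
\<close>

lemma two_sided_profile_surj:
  assumes "length ts = n - q" "slack_ok m 0 ts" "length us = q" "slack_ok m 0 us" "q \<le> n"
  shows "(ts, us) \<in> two_sided_profile n ` increasing_points n"
proof -
  obtain z where z: "generic_chain (n - q) z" "profile (n - q) z = ts"
    using profile_surj[OF assms(2)] assms(1) by auto
  obtain w where w: "generic_chain q w" "profile q w = us"
    using profile_surj[OF assms(4)] assms(3) by auto
  define x where "x = (\<lambda>i\<in>{1..n}. if i \<le> q then - w (q - i) else z (i - Suc q))"
  have sgn: "i \<le> q \<Longrightarrow> x i < 0" "q < i \<Longrightarrow> 0 < x i" if "i \<in> {1..n}" for i
    using that z(1) w(1) by (auto simp: x_def generic_chain_def)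
  have off: "x i \<noteq> a ^ k * x j" if ij: "i \<in> {1..n}" "j \<in> {1..n}" "i \<noteq> j" "k \<le> m" for i j k
  proof -
    consider "i \<le> q" "j \<le> q" | "q < i" "q < j" | "i \<le> q" "q < j" | "q < i" "j \<le> q" by linarith
    then show ?thesis
    proof cases
      case 1
      then have "w (q - i) \<noteq> a ^ k * w (q - j)" using ij by (intro generic_chain_compare(1)[OF w(1)]) auto
      then show ?thesis using 1 ij by (simp add: x_def)
    next
      case 2
      then have "z (i - Suc q) \<noteq> a ^ k * z (j - Suc q)"
        using ij by (intro generic_chain_compare(1)[OF z(1)]) auto
      then show ?thesis using 2 ij by (simp add: x_def)
    next
      case 3
      then have "0 < a ^ k * x j" using sgn ij a1 by simp
      then show ?thesis using sgn(1)[OF ij(1)] 3 by linarith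
    next
      case 4
      then have "a ^ k * x j < 0" using sgn ij a1 by (simp add: mult_pos_neg)
      then show ?thesis using sgn(2)[OF ij(1)] 4 by linarith
    qed
  qed
  have inc: "x i < x j" if ij: "i \<in> {1..n}" "j \<in> {1..n}" "i < j" for i j
  proof -
    consider "j \<le> q" | "q < i" | "i \<le> q" "q < j" by linarith
    then show ?thesis
    proof cases
      case 1
      then have "w (q - j) < w (q - i)" using ij w(1) by (auto simp: generic_chain_def)
      then show ?thesis using 1 ij by (simp add: x_def)
    next
      case 2
      then have "z (i - Suc q) < z (j - Suc q)" using ij z(1) by (auto simp: generic_chain_def)
      then show ?thesis using 2 ij by (simp add: x_def)
    next
      case 3
      then show ?thesis using sgn(1)[OF ij(1)] sgn(2)[OF ij(2)] by linarith
    qed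
  qed
  have "x i \<noteq> 0" if "i \<in> {1..n}" for i
    using sgn[OF that] by (cases "i \<le> q") auto
  moreover have "x \<in> {1..n} \<rightarrow>\<^sub>E UNIV" by (simp add: x_def)
  ultimately have x: "x \<in> increasing_points n"
    using off inc unfolding increasing_points_def complement_points_def by blast
  have "x i < 0 \<longleftrightarrow> i \<le> q" if "i \<in> {1..n}" for i
    using sgn[OF that] by (cases "i \<le> q") auto
  then have "{i \<in> {1..n}. x i < 0} = {1..q}"
    using assms(5) by auto
  then have q: "negatives n x = q" by (simp add: negatives_def)
  have "profile (n - q) (\<lambda>i. x (Suc (q + i))) = profile (n - q) z"
    by (rule profile_cong) (auto simp: x_def)
  moreover have "profile q (\<lambda>i. - x (q - i)) = profile q w"
    by (rule profile_cong) (use assms(5) in \<open>auto simp: x_def\<close>)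
  ultimately have "two_sided_profile n x = (ts, us)"
    using z w q by (simp add: two_sided_profile_def)
  with x show ?thesis by force
qed

lemma card_two_sided_profiles: "card (two_sided_profile n ` increasing_points n) = raney_nat m n 2"
proof -
  let ?W = "\<lambda>p. {ts. length ts = p \<and> slack_ok m 0 ts}"
  have "two_sided_profile n x \<in> ?W (n - negatives n x) \<times> ?W (negatives n x)"
    if "x \<in> increasing_points n" for x
    using slack_ok_profile[OF generic_halves(1)[OF that]] slack_ok_profile[OF generic_halves(2)[OF that]]
    by (simp add: two_sided_profile_def Let_def profile_def)
  then have "two_sided_profile n ` increasing_points n \<subseteq> (\<Union>q\<in>{..n}. ?W (n - q) \<times> ?W q)"
    using negatives_le by blast
  moreover have "(\<Union>q\<in>{..n}. ?W (n - q) \<times> ?W q) \<subseteq> two_sided_profile n ` increasing_points n"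
    using two_sided_profile_surj by auto
  ultimately have "two_sided_profile n ` increasing_points n = (\<Union>q\<in>{..n}. ?W (n - q) \<times> ?W q)"
    by (rule subset_antisym)
  also have "card \<dots> = (\<Sum>q\<le>n. card (?W (n - q) \<times> ?W q))"
    by (rule card_UN_disjoint) (use card_slack_ok in auto)
  also have "\<dots> = (\<Sum>q\<le>n. raney_nat m q 1 * raney_nat m (n - q) 1)"
    using card_slack_ok[of _ m 0] by (simp add: card_cartesian_product mult.commute)
  also have "\<dots> = raney_nat m n 2" using raney_nat_convolution[of m 1 n 1] by (simp add: numeral_2_eq_2)
  finally show ?thesis .
qed

end

section \<open>Permuting the coordinates\<close>

text \<open>
  Extended by the identity outside \<open>{1..n}\<close>, so that it is a permutation in the sense of
  \<open>permutes\<close>; its inverse sorts the coordinates.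
\<close>

definition coord_rank :: "nat \<Rightarrow> (nat \<Rightarrow> real) \<Rightarrow> nat \<Rightarrow> nat" where
  "coord_rank n x i = (if i \<in> {1..n} then card {j \<in> {1..n}. x j \<le> x i} else i)"

lemma coord_rank_mono:
  assumes "i \<in> {1..n}" "j \<in> {1..n}"
  shows "x i < x j \<longleftrightarrow> coord_rank n x i < coord_rank n x j"
proof -
  have mono: "coord_rank n x i \<le> coord_rank n x j" if "x i \<le> x j" "i \<in> {1..n}" "j \<in> {1..n}" for i j
  proof -
    have "card {l \<in> {1..n}. x l \<le> x i} \<le> card {l \<in> {1..n}. x l \<le> x j}"
      using that(1) by (intro card_mono) auto
    then show ?thesis using that by (simp add: coord_rank_def)
  qed
  have "coord_rank n x i < coord_rank n x j" if "x i < x j"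
  proof -
    have "j \<in> {l \<in> {1..n}. x l \<le> x j}" "j \<notin> {l \<in> {1..n}. x l \<le> x i}"
      using that assms by auto
    moreover have "{l \<in> {1..n}. x l \<le> x i} \<subseteq> {l \<in> {1..n}. x l \<le> x j}" using that by auto
    ultimately have "{l \<in> {1..n}. x l \<le> x i} \<subset> {l \<in> {1..n}. x l \<le> x j}" by blast
    then have "card {l \<in> {1..n}. x l \<le> x i} < card {l \<in> {1..n}. x l \<le> x j}"
      by (intro psubset_card_mono) auto
    then show ?thesis using assms by (simp add: coord_rank_def)
  qed
  then show ?thesis using mono[of j i] assms by force
qed

lemma coord_rank_permutes:
  assumes "inj_on x {1..n}"
  shows "coord_rank n x permutes {1..n}"
proof (rule bij_imp_permutes)
  have "inj_on (coord_rank n x) {1..n}"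
  proof (rule inj_onI)
    fix i j assume ij: "i \<in> {1..n}" "j \<in> {1..n}" "coord_rank n x i = coord_rank n x j"
    then have "x i = x j" using coord_rank_mono[of i n j x] coord_rank_mono[of j n i x] by simp
    then show "i = j" using assms ij by (auto dest: inj_onD)
  qed
  moreover have "coord_rank n x ` {1..n} \<subseteq> {1..n}"
  proof (rule image_subsetI)
    fix i assume i: "i \<in> {1..n}"
    have "card {j \<in> {1..n}. x j \<le> x i} \<le> card {1..n}" by (intro card_mono) auto
    moreover have "card {j \<in> {1..n}. x j \<le> x i} > 0" using i by (subst card_gt_0_iff) auto
    ultimately show "coord_rank n x i \<in> {1..n}" using i by (simp add: coord_rank_def)
  qed
  ultimately show "bij_betw (coord_rank n x) {1..n} {1..n}"
    by (simp add: bij_betw_def endo_inj_surj)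
qed (auto simp: coord_rank_def)

lemma complement_points_permute:
  assumes "p permutes {1..n}" and "x \<in> complement_points a m n"
  shows "x \<circ> p \<in> complement_points a m n"
proof -
  have p: "p i \<in> {1..n} \<longleftrightarrow> i \<in> {1..n}" "p i = p j \<longleftrightarrow> i = j" for i j
    using permutes_in_image[OF assms(1)] inj_eq[OF permutes_inj[OF assms(1)]] by blast+
  have "(x \<circ> p) i = undefined" if "i \<notin> {1..n}" for i
  proof -
    have "p i \<notin> {1..n}" using p(1) that by blast
    with assms(2)[unfolded complement_points_def mem_Collect_eq, THEN conjunct1]
    show ?thesis unfolding comp_apply by (rule PiE_arb)
  qed
  then have "x \<circ> p \<in> {1..n} \<rightarrow>\<^sub>E UNIV" by (simp add: PiE_iff extensional_def)
  moreover have "(x \<circ> p) i \<noteq> 0" if "i \<in> {1..n}" for i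
    using complement_pointsD(1)[OF assms(2)] that p by simp
  moreover have "(x \<circ> p) i \<noteq> a ^ k * (x \<circ> p) j"
    if "i \<in> {1..n}" "j \<in> {1..n}" "i \<noteq> j" "k \<le> m" for i j k
    using complement_pointsD(2)[OF assms(2), of "p i" "p j"] that p by simp
  ultimately show ?thesis unfolding complement_points_def by blast
qed

lemma same_side_permute:
  assumes "p permutes {1..n}" and "same_side a m n x y"
  shows "same_side a m n (x \<circ> p) (y \<circ> p)"
proof -
  have p: "p i \<in> {1..n} \<longleftrightarrow> i \<in> {1..n}" "p i = p j \<longleftrightarrow> i = j" for i j
    using permutes_in_image[OF assms(1)] inj_eq[OF permutes_inj[OF assms(1)]] by blast+
  show ?thesis
    using assms(2) p unfolding same_side_def by (simp only: comp_apply) blast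
qed

lemma same_side_order:
  assumes "same_side a m n x y" "i \<in> {1..n}" "j \<in> {1..n}"
  shows "x i < x j \<longleftrightarrow> y i < y j"
proof (cases "i = j")
  case False
  then have "x i < a ^ 0 * x j \<longleftrightarrow> y i < a ^ 0 * y j"
    using assms unfolding same_side_def by blast
  then show ?thesis by simp
qed simp

lemma same_side_coord_rank:
  assumes "same_side a m n x y"
  shows "coord_rank n x = coord_rank n y"
proof
  fix i show "coord_rank n x i = coord_rank n y i"
  proof (cases "i \<in> {1..n}")
    case True
    then have "x j \<le> x i \<longleftrightarrow> y j \<le> y i" if "j \<in> {1..n}" for j
      using same_side_order[OF assms True that] by (simp add: not_less[symmetric])
    then have "{j \<in> {1..n}. x j \<le> x i} = {j \<in> {1..n}. y j \<le> y i}" by blast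
    then show ?thesis by (simp add: coord_rank_def)
  qed (simp only: coord_rank_def if_False)
qed

lemma complement_points_inj:
  assumes "x \<in> complement_points a m n"
  shows "inj_on x {1..n}"
proof (rule inj_onI)
  fix i j assume "i \<in> {1..n}" "j \<in> {1..n}" "x i = x j"
  then show "i = j" using complement_pointsD(2)[OF assms, of i j 0] by auto
qed

lemma same_side_class_eq:
  assumes "x \<in> complement_points a m n" "y \<in> complement_points a m n"
  shows "{z \<in> complement_points a m n. same_side a m n x z} = {z \<in> complement_points a m n. same_side a m n y z}
    \<longleftrightarrow> same_side a m n x y" (is "?C x = ?C y \<longleftrightarrow> _")
proof
  assume "?C x = ?C y"
  moreover have "y \<in> ?C y" using assms(2) by (simp add: same_side_def)
  ultimately have "y \<in> ?C x" by (simp only:)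
  then show "same_side a m n x y" by simp
next
  assume "same_side a m n x y"
  then have "same_side a m n x z \<longleftrightarrow> same_side a m n y z" for z
    by (simp add: same_side_def)
  then show "?C x = ?C y" by simp
qed

section \<open>Counting the regions\<close>

lemma card_image_eq:
  assumes "\<And>x y. x \<in> A \<Longrightarrow> y \<in> A \<Longrightarrow> f x = f y \<longleftrightarrow> g x = g y"
  shows "card (f ` A) = card (g ` A)"
proof -
  have "inj_on (\<lambda>c. g (inv_into A f c)) (f ` A)"
  proof (rule inj_onI)
    fix c d assume cd: "c \<in> f ` A" "d \<in> f ` A" "g (inv_into A f c) = g (inv_into A f d)"
    then have "f (inv_into A f c) = f (inv_into A f d)"
      using assms inv_into_into by metis
    with cd show "c = d" by (simp add: f_inv_into_f)
  qed
  moreover have "(\<lambda>c. g (inv_into A f c)) ` f ` A = g ` A"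
  proof -
    have "g (inv_into A f (f x)) = g x" if "x \<in> A" for x
      using assms[of "inv_into A f (f x)" x] that by (simp add: inv_into_into f_inv_into_f)
    then show ?thesis by (simp add: image_image)
  qed
  ultimately show ?thesis by (metis card_image)
qed

context dilation
begin

definition sort_point :: "nat \<Rightarrow> (nat \<Rightarrow> real) \<Rightarrow> nat \<Rightarrow> real" where
  "sort_point n x = x \<circ> inv (coord_rank n x)"

lemma sort_point_increasing:
  assumes x: "x \<in> complement_points a m n"
  shows "sort_point n x \<in> increasing_points n"
proof -
  note p = coord_rank_permutes[OF complement_points_inj[OF x]]
  have "sort_point n x i < sort_point n x j" if ij: "i \<in> {1..n}" "j \<in> {1..n}" "i < j" for i j
  proof -
    have "inv (coord_rank n x) i \<in> {1..n}" "inv (coord_rank n x) j \<in> {1..n}"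
      using ij permutes_in_image[OF permutes_inv[OF p]] by blast+
    then show ?thesis
      using coord_rank_mono[of "inv (coord_rank n x) i" n "inv (coord_rank n x) j" x] ij
      by (simp add: sort_point_def permutes_inverses[OF p])
  qed
  then show ?thesis
    using complement_points_permute[OF permutes_inv[OF p] x]
    unfolding increasing_points_def sort_point_def by blast
qed

lemma coord_rank_of_permuted_increasing:
  assumes x: "x \<in> increasing_points n" and p: "p permutes {1..n}"
  shows "coord_rank n (x \<circ> p) = p"
proof
  fix i show "coord_rank n (x \<circ> p) i = p i"
  proof (cases "i \<in> {1..n}")
    case True
    then have pi: "p i \<in> {1..n}" using permutes_in_image[OF p] by blast
    have le: "x j \<le> x l \<longleftrightarrow> j \<le> l" if "j \<in> {1..n}" "l \<in> {1..n}" for j l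
      using increasing_pointsD(2)[OF x that] increasing_pointsD(2)[OF x that(2,1)]
      by (cases j l rule: linorder_cases) auto
    have "p ` {j \<in> {1..n}. x (p j) \<le> x (p i)} = {l \<in> p ` {1..n}. x l \<le> x (p i)}" by auto
    also have "\<dots> = {l \<in> {1..n}. x l \<le> x (p i)}" using permutes_image[OF p] by simp
    also have "\<dots> = {1..p i}" using le[OF _ pi] pi by auto
    finally have "card (p ` {j \<in> {1..n}. x (p j) \<le> x (p i)}) = p i" by simp
    then have "card {j \<in> {1..n}. x (p j) \<le> x (p i)} = p i"
      using card_image[OF inj_on_subset[OF permutes_inj[OF p] subset_UNIV]] by simp
    then show ?thesis using True by (simp add: coord_rank_def)
  next
    case False
    then have "p i = i" by (rule permutes_not_in[OF p])
    with False show ?thesis by (simp only: coord_rank_def if_False)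
  qed
qed

lemma card_increasing_classes:
  "card ((\<lambda>x. {y \<in> complement_points a m n. same_side a m n x y}) ` increasing_points n) = raney_nat m n 2"
proof -
  have "card ((\<lambda>x. {y \<in> complement_points a m n. same_side a m n x y}) ` increasing_points n)
      = card (two_sided_profile n ` increasing_points n)"
    by (rule card_image_eq)
      (simp only: same_side_class_eq increasing_pointsD(1) same_side_iff_profile)
  then show ?thesis by (simp only: card_two_sided_profiles)
qed

text \<open>
  The sorting permutation together with the profile of the sorted point is a complete invariant on the
  whole complement, and its two components vary independently.
\<close>

lemma card_classes:
  "card ((\<lambda>x. {y \<in> complement_points a m n. same_side a m n x y}) ` complement_points a m n)
     = fact n * raney_nat m n 2"
proof -
  let ?U = "complement_points a m n" and ?P = "{p. p permutes {1..n}}"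
  let ?f = "\<lambda>x. (coord_rank n x, two_sided_profile n (sort_point n x))"
  have complete: "same_side a m n x y \<longleftrightarrow> ?f x = ?f y" if x: "x \<in> ?U" and y: "y \<in> ?U" for x y
  proof -
    note p = coord_rank_permutes[OF complement_points_inj[OF x]]
    have prof: "two_sided_profile n (sort_point n x) = two_sided_profile n (sort_point n y)
        \<longleftrightarrow> same_side a m n (sort_point n x) (sort_point n y)"
      using same_side_iff_profile[OF sort_point_increasing[OF x] sort_point_increasing[OF y]] by simp
    show ?thesis
    proof
      assume s: "same_side a m n x y"
      then have r: "coord_rank n x = coord_rank n y" by (rule same_side_coord_rank)
      have "same_side a m n (sort_point n x) (sort_point n y)"
        unfolding sort_point_def r[symmetric] by (rule same_side_permute[OF permutes_inv[OF p] s])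
      with prof r show "?f x = ?f y" by simp
    next
      assume "?f x = ?f y"
      then have r: "coord_rank n x = coord_rank n y" and s: "same_side a m n (sort_point n x) (sort_point n y)"
        using prof by simp_all
      have "same_side a m n (sort_point n x \<circ> coord_rank n x) (sort_point n y \<circ> coord_rank n x)"
        by (rule same_side_permute[OF p s])
      then show "same_side a m n x y"
        by (simp add: sort_point_def r[symmetric] comp_assoc permutes_inv_o(2)[OF p])
    qed
  qed
  have "?f ` ?U = ?P \<times> two_sided_profile n ` increasing_points n"
  proof (intro subset_antisym subsetI)
    fix c assume "c \<in> ?f ` ?U"
    then show "c \<in> ?P \<times> two_sided_profile n ` increasing_points n"
      using coord_rank_permutes[OF complement_points_inj] sort_point_increasing by blast
  next
    fix c assume "c \<in> ?P \<times> two_sided_profile n ` increasing_points n"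
    then obtain p x where c: "c = (p, two_sided_profile n x)" and p: "p permutes {1..n}"
      and x: "x \<in> increasing_points n" by blast
    have r: "coord_rank n (x \<circ> p) = p" by (rule coord_rank_of_permuted_increasing[OF x p])
    have "sort_point n (x \<circ> p) = x"
      unfolding sort_point_def r by (simp add: comp_assoc permutes_inv_o(1)[OF p])
    then have "c = ?f (x \<circ> p)" using c r by simp
    then show "c \<in> ?f ` ?U"
      using complement_points_permute[OF p increasing_pointsD(1)[OF x]] by blast
  qed
  then have "card (?f ` ?U) = fact n * raney_nat m n 2"
    by (simp add: card_cartesian_product card_permutations card_two_sided_profiles)
  moreover have "card ((\<lambda>x. {y \<in> ?U. same_side a m n x y}) ` ?U) = card (?f ` ?U)"
    by (rule card_image_eq) (simp only: same_side_class_eq complete)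
  ultimately show ?thesis by simp
qed

text \<open>
  The form with \<open>k = 0\<close> compares coordinates, so a sign class consists of increasing points as soon as
  it contains one.
\<close>

lemma increasing_regions_eq:
  "{R \<in> regions n (arrangement a m n). \<forall>x\<in>R. \<forall>i\<in>{1..n}. \<forall>j\<in>{1..n}. i < j \<longrightarrow> x i < x j}
     = (\<lambda>x. {y \<in> complement_points a m n. same_side a m n x y}) ` increasing_points n"
    (is "?L = ?C ` _")
proof -
  have a0: "0 < a" using a1 by simp
  have self: "x \<in> ?C x" if "x \<in> complement_points a m n" for x
    using that by (simp add: same_side_def)
  have "?C x \<in> ?L" if x: "x \<in> increasing_points n" for x
  proof -
    have "y i < y j" if "y \<in> ?C x" "i \<in> {1..n}" "j \<in> {1..n}" "i < j" for y i j
      using same_side_order[of a m n x y i j] increasing_pointsD(2)[OF x] that by blast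
    then show ?thesis using increasing_pointsD(1)[OF x] unfolding regions_eq[OF a0] by blast
  qed
  moreover have "R \<in> ?C ` increasing_points n" if R: "R \<in> ?L" for R
  proof -
    obtain x where x: "x \<in> complement_points a m n" "R = ?C x"
      using R unfolding regions_eq[OF a0] by blast
    then have "x \<in> R" using self by blast
    then have "x \<in> increasing_points n" using R x(1) unfolding increasing_points_def by blast
    then show ?thesis using x(2) by blast
  qed
  ultimately show ?thesis by blast
qed

end

theorem mainTheorem4:
  fixes m n :: nat and a :: real
  assumes "m \<ge> 1" and "n \<ge> 1" and "a > 1"
  shows "real (num_increasing_regions n (arrangement a m n))
           = 2 / real (n * (m + 1) + 2) * real ((n * (m + 1) + 2) choose n)
       \<and> 2 / real (n * (m + 1) + 2) * real ((n * (m + 1) + 2) choose n) = raney n m 2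
       \<and> real (num_regions n (arrangement a m n)) = fact n * raney n m 2"
proof -
  interpret dilation m a by unfold_locales (rule assms(3))
  have "0 < a" using assms(3) by simp
  have closed: "2 / real (n * (m + 1) + 2) * real ((n * (m + 1) + 2) choose n) = raney n m 2"
    by (simp add: raney_def)
  have count: "real (raney_nat m n 2) = raney n m 2" by (simp add: raney_nat_eq_raney)
  have "num_increasing_regions n (arrangement a m n) = raney_nat m n 2"
    unfolding num_increasing_regions_def increasing_regions_eq by (rule card_increasing_classes)
  moreover have "num_regions n (arrangement a m n) = fact n * raney_nat m n 2"
    unfolding num_regions_def regions_eq[OF \<open>0 < a\<close>] by (rule card_classes)
  ultimately show ?thesis by (simp only: closed count of_nat_mult of_nat_fact simp_thms)
qed

end
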